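(* Let $\Gamma$ be an abelian group and $f:\Gamma\to\mathbb{C}$ a function with $f(0)=0$, $|f(\Gamma)|\ge 2$ and $\big(f(\alpha+\beta)-f(\alpha)-f(\beta)\big)\big(f(\alpha)-f(\beta)\big)=0$ for all $\alpha,\beta\in\Gamma$. Then the Witt type Lie algebra $V(f)$ admits a non-trivial $\mathrm{Hom}$-Lie algebra structure.
   Context: The Witt type Lie algebra $V(f)$ is the complex vector space with basis $\{e_\alpha\}_{\alpha\in\Gamma}$ and bracket $[e_\alpha,e_\beta]=(f(\beta)-f(\alpha))e_{\alpha+\beta}$. A $\mathrm{Hom}$-Lie algebra structure on a Lie algebra $(L,[\cdot,\cdot])$ is a linear map $\varphi:L\to L$ such that $[\varphi(x),[y,z]]+[\varphi(y),[z,x]]+[\varphi(z),[x,y]]=0$ for all $x,y,z\in L$. It is non-trivial if $\varphi$ is not a scalar multiple of the identity map. *)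

theory Defs
  imports Complex_Main "HOL-Library.Poly_Mapping"
begin

locale lie_algebra = vector_space scale
  for scale :: "'k::field \<Rightarrow> 'v::ab_group_add \<Rightarrow> 'v" +
  fixes bracket :: "'v \<Rightarrow> 'v \<Rightarrow> 'v"
  assumes linear_left: "Vector_Spaces.linear scale scale (\<lambda>x. bracket x y)"
    and linear_right: "Vector_Spaces.linear scale scale (bracket x)"
    and alternating: "bracket x x = 0"
    and jacobi: "bracket x (bracket y z) + bracket y (bracket z x) + bracket z (bracket x y) = 0"

locale hom_lie_structure =
  lie_algebra scale bracket + Vector_Spaces.linear scale scale \<phi>
  for scale :: "'k::field \<Rightarrow> 'v::ab_group_add \<Rightarrow> 'v"
    and bracket :: "'v \<Rightarrow> 'v \<Rightarrow> 'v"
    and \<phi> :: "'v \<Rightarrow> 'v" +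
  assumes hom_jacobi:
    "bracket (\<phi> x) (bracket y z) + bracket (\<phi> y) (bracket z x) + bracket (\<phi> z) (bracket x y) = 0"

definition nontrivial_hom_lie_structure ::
  "('k::field \<Rightarrow> 'v::ab_group_add \<Rightarrow> 'v) \<Rightarrow> ('v \<Rightarrow> 'v \<Rightarrow> 'v) \<Rightarrow> ('v \<Rightarrow> 'v) \<Rightarrow> bool"
  where "nontrivial_hom_lie_structure scale bracket \<phi> \<longleftrightarrow>
    hom_lie_structure scale bracket \<phi> \<and> \<not> (\<exists>c. \<forall>x. \<phi> x = scale c x)"

text \<open>
  The underlying vector space of \<open>V(f)\<close> is the type of finitely supported functions
  \<^typ>\<open>'g \<Rightarrow>\<^sub>0 complex\<close>, with \<open>Poly_Mapping.single \<alpha> 1\<close> as the basis vector \<open>e\<^sub>\<alpha>\<close>.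
\<close>

definition pm_scale :: "complex \<Rightarrow> ('g \<Rightarrow>\<^sub>0 complex) \<Rightarrow> ('g \<Rightarrow>\<^sub>0 complex)"
  where "pm_scale c x = Poly_Mapping.map ((*) c) x"

definition witt_bracket ::
  "('g::ab_group_add \<Rightarrow> complex) \<Rightarrow> ('g \<Rightarrow>\<^sub>0 complex) \<Rightarrow> ('g \<Rightarrow>\<^sub>0 complex) \<Rightarrow> ('g \<Rightarrow>\<^sub>0 complex)"
  where "witt_bracket f x y =
    (\<Sum>\<alpha>\<in>Poly_Mapping.keys x. \<Sum>\<beta>\<in>Poly_Mapping.keys y.
      Poly_Mapping.single (\<alpha> + \<beta>)
        (Poly_Mapping.lookup x \<alpha> * Poly_Mapping.lookup y \<beta> * (f \<beta> - f \<alpha>)))"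

lemma lookup_pm_scale [simp]:
  "Poly_Mapping.lookup (pm_scale c x) \<alpha> = c * Poly_Mapping.lookup x \<alpha>"
  by (simp add: pm_scale_def Poly_Mapping.map.rep_eq when_def)

lemma vector_space_pm_scale: "vector_space pm_scale"
  by unfold_locales (auto intro!: poly_mapping_eqI simp: lookup_add algebra_simps)

interpretation pm: vector_space pm_scale
  by (rule vector_space_pm_scale)

lemma pm_basis_independent:
  "pm.independent (range (\<lambda>\<alpha>. Poly_Mapping.single \<alpha> 1))"
proof
  let ?e = "\<lambda>\<alpha>::'a. Poly_Mapping.single \<alpha> (1::complex)"
  assume "pm.dependent (range ?e)"
  then obtain a where a: "?e a \<in> pm.span (range ?e - {?e a})"
    unfolding pm.dependent_def by auto
  let ?S = "{x. Poly_Mapping.lookup x a = (0::complex)}"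
  have "pm.span (range ?e - {?e a}) \<subseteq> ?S"
  proof (rule pm.span_minimal)
    show "range ?e - {?e a} \<subseteq> ?S"
      by (auto simp: lookup_single when_def)
    show "pm.subspace ?S"
      by (auto simp: pm.subspace_def lookup_add)
  qed
  with a show False by auto
qed

lemma pm_expand:
  "x = (\<Sum>\<alpha>\<in>Poly_Mapping.keys x. pm_scale (Poly_Mapping.lookup x \<alpha>) (Poly_Mapping.single \<alpha> 1))"
proof (rule poly_mapping_eqI)
  fix k
  show "Poly_Mapping.lookup x k = Poly_Mapping.lookup (\<Sum>\<alpha>\<in>Poly_Mapping.keys x. pm_scale (Poly_Mapping.lookup x \<alpha>) (Poly_Mapping.single \<alpha> 1)) k"
    by (simp add: lookup_sum lookup_single when_def in_keys_iff sum.delta if_distrib cong: if_cong)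
qed

lemma pm_basis_span:
  "pm.span (range (\<lambda>\<alpha>. Poly_Mapping.single \<alpha> 1)) = UNIV"
proof -
  have "x \<in> pm.span (range (\<lambda>\<alpha>. Poly_Mapping.single \<alpha> 1))" for x :: "'a \<Rightarrow>\<^sub>0 complex"
    by (subst pm_expand) (intro pm.span_sum pm.span_scale pm.span_base rangeI)
  then show ?thesis by auto
qed

lemma witt_bracket_basis:
  "witt_bracket f (Poly_Mapping.single \<alpha> 1) (Poly_Mapping.single \<beta> 1) =
    pm_scale (f \<beta> - f \<alpha>) (Poly_Mapping.single (\<alpha> + \<beta>) 1)"
  by (rule poly_mapping_eqI) (simp add: witt_bracket_def lookup_single when_def)

lemma witt_bracket_superset:
  assumes "finite A" "finite B" "Poly_Mapping.keys x \<subseteq> A" "Poly_Mapping.keys y \<subseteq> B"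
  shows "witt_bracket f x y = (\<Sum>\<alpha>\<in>A. \<Sum>\<beta>\<in>B. Poly_Mapping.single (\<alpha> + \<beta>)
        (Poly_Mapping.lookup x \<alpha> * Poly_Mapping.lookup y \<beta> * (f \<beta> - f \<alpha>)))"
  unfolding witt_bracket_def using assms
  by (intro sum.mono_neutral_cong_left) (auto simp: in_keys_iff intro!: sum.mono_neutral_left)

lemma pm_scale_single [simp]: "pm_scale c (Poly_Mapping.single a d) = Poly_Mapping.single a (c * d)"
  by (rule poly_mapping_eqI) (simp add: lookup_single when_def)

lemma linear_witt_left: "Vector_Spaces.linear pm_scale pm_scale (\<lambda>x. witt_bracket f x z)"
proof -
  have "witt_bracket f (x + y) z = witt_bracket f x z + witt_bracket f y z" for x y
  proof -
    let ?A = "Poly_Mapping.keys x \<union> Poly_Mapping.keys y" and ?B = "Poly_Mapping.keys z"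
    have *: "Poly_Mapping.keys (x + y) \<subseteq> ?A" by (rule Poly_Mapping.keys_add)
    show ?thesis
      using * by (simp add: witt_bracket_superset[of ?A ?B] lookup_add distrib_right single_add sum.distrib)
  qed
  moreover have "witt_bracket f (pm_scale c x) z = pm_scale c (witt_bracket f x z)" for c x
  proof -
    have *: "Poly_Mapping.keys (pm_scale c x) \<subseteq> Poly_Mapping.keys x" by (auto simp: in_keys_iff)
    show ?thesis
      using * by (simp add: witt_bracket_superset[of "Poly_Mapping.keys x" "Poly_Mapping.keys z"]
          pm.scale_sum_right mult.assoc)
  qed
  ultimately show ?thesis
    by (simp add: Vector_Spaces.linear_iff vector_space_pm_scale)
qed

lemma witt_bracket_antisym: "witt_bracket f x y = - witt_bracket f y x"
proof -
  have "witt_bracket f y x = (\<Sum>\<alpha>\<in>Poly_Mapping.keys x. \<Sum>\<beta>\<in>Poly_Mapping.keys y.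
      Poly_Mapping.single (\<beta> + \<alpha>)
        (Poly_Mapping.lookup y \<beta> * Poly_Mapping.lookup x \<alpha> * (f \<alpha> - f \<beta>)))"
    unfolding witt_bracket_def by (rule sum.swap)
  also have "\<dots> = - witt_bracket f x y"
    unfolding witt_bracket_def sum_negf[symmetric] single_uminus[symmetric]
    by (intro sum.cong refl) (simp add: algebra_simps)
  finally show ?thesis by simp
qed

lemma linear_witt_right: "Vector_Spaces.linear pm_scale pm_scale (witt_bracket f z)"
proof -
  have "witt_bracket f z = (\<lambda>x. - witt_bracket f x z)"
    by (rule ext) (rule witt_bracket_antisym)
  moreover have "Vector_Spaces.linear pm_scale pm_scale (\<lambda>x. - witt_bracket f x z)"
    using linear_witt_left[of f z]
    by (simp add: Vector_Spaces.linear_iff pm.scale_minus_right)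
  ultimately show ?thesis by simp
qed

lemma witt_bracket_alternating: "witt_bracket f x x = 0"
proof (rule poly_mapping_eqI)
  fix k
  have "witt_bracket f x x = - witt_bracket f x x" by (rule witt_bracket_antisym)
  then have "Poly_Mapping.lookup (witt_bracket f x x) k = - Poly_Mapping.lookup (witt_bracket f x x) k"
    by (metis lookup_uminus uminus_apply)
  then show "Poly_Mapping.lookup (witt_bracket f x x) k = Poly_Mapping.lookup 0 k" by simp
qed

lemma pm_induct:
  assumes "Vector_Spaces.linear pm_scale pm_scale F"
    and "\<And>\<alpha>. F (Poly_Mapping.single \<alpha> 1) = 0"
  shows "F x = 0"
proof -
  interpret F: Vector_Spaces.linear pm_scale pm_scale F by fact
  show ?thesis
    by (subst pm_expand) (simp add: F.sum F.scale assms(2) del: pm_scale_single)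
qed

lemma lie_algebra_witt:
  fixes f :: "'g::ab_group_add \<Rightarrow> complex"
  assumes "\<And>\<alpha> \<beta>. (f (\<alpha> + \<beta>) - f \<alpha> - f \<beta>) * (f \<alpha> - f \<beta>) = 0"
  shows "lie_algebra pm_scale (witt_bracket f)"
proof -
  let ?b = "witt_bracket f"
  let ?e = "\<lambda>\<alpha>::'g. Poly_Mapping.single \<alpha> (1::complex)"
  let ?J = "\<lambda>x y z. ?b x (?b y z) + ?b y (?b z x) + ?b z (?b x y)"
  note L = linear_witt_left[of f, unfolded Vector_Spaces.linear_iff]
    linear_witt_right[of f, unfolded Vector_Spaces.linear_iff]
  have scale_l: "?b (pm_scale c x) y = pm_scale c (?b x y)"
    and scale_r: "?b x (pm_scale c y) = pm_scale c (?b x y)"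
    and add_l: "?b (x + x') y = ?b x y + ?b x' y"
    and add_r: "?b x (y + y') = ?b x y + ?b x y'" for c x x' y y'
    using L by auto
  have lin: "Vector_Spaces.linear pm_scale pm_scale (\<lambda>x. ?J x y z)"
    "Vector_Spaces.linear pm_scale pm_scale (\<lambda>y. ?J x y z)"
    "Vector_Spaces.linear pm_scale pm_scale (\<lambda>z. ?J x y z)" for x y z
    by (simp_all add: Vector_Spaces.linear_iff vector_space_pm_scale add_l add_r scale_l scale_r
        pm.scale_right_distrib algebra_simps)
  have coef: "(f b - f a) * (f (a + b) - f c) = (f b - f a) * (f a + f b - f c)" for a b c
    using assms[of a b] by (auto simp: algebra_simps)
  have basis: "?b (?e a) (?b (?e b) (?e c)) = Poly_Mapping.single (a + b + c) ((f c - f b) * (f b + f c - f a))"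
    for a b c
    by (simp only: witt_bracket_basis scale_r) (simp add: coef add_ac)
  have "?J (?e a) (?e b) (?e c) = 0" for a b c
  proof -
    have "?J (?e a) (?e b) (?e c) = Poly_Mapping.single (a + b + c)
      ((f c - f b) * (f b + f c - f a) + (f a - f c) * (f c + f a - f b) + (f b - f a) * (f a + f b - f c))"
      unfolding basis single_add by (simp add: add_ac)
    also have "\<dots> = 0" by (simp add: algebra_simps)
    finally show ?thesis .
  qed
  then have "?J (?e a) (?e b) z = 0" for a b z
    by (rule pm_induct[OF lin(3)])
  then have "?J (?e a) y z = 0" for a y z
    by (rule pm_induct[OF lin(2)])
  then have J: "?J x y z = 0" for x y z
    by (rule pm_induct[OF lin(1)])
  show ?thesis
    by (intro lie_algebra.intro lie_algebra_axioms.intro vector_space_pm_scale linear_witt_left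
        linear_witt_right witt_bracket_alternating J)
qed

end

theory Submission
  imports Defs
begin

text \<open>
  Two linear maps are candidates for a Hom-Lie structure on \<open>V(f)\<close>: the shift
  \<open>e\<^sub>\<alpha> \<mapsto> e\<^bsub>\<alpha> + \<gamma>\<^esub>\<close> for a fixed \<open>\<gamma> \<noteq> 0\<close>, and the projection onto the line
  spanned by \<open>e\<^sub>0\<close>.

  The shift satisfies the Hom-Jacobi identity as soon as
  \<open>f (\<alpha> + \<gamma>) = f \<alpha> + f \<gamma>\<close> for all \<open>\<alpha>\<close>: the coefficient of \<open>e\<^bsub>\<alpha> + \<beta> + \<delta> + \<gamma>\<^esub>\<close> is
  then the cyclic sum of \<open>(f \<delta> - f \<beta>) (f \<beta> + f \<delta> - f \<alpha> - f \<gamma>)\<close>, which vanishes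
  identically.  The projection satisfies it as soon as two non-zero elements with
  different values of \<open>f\<close> always have sum \<open>0\<close>, since \<open>[e\<^sub>0, [e\<^sub>\<beta>, e\<^sub>\<delta>]]\<close> is then zero for
  non-zero \<open>\<beta>\<close>, \<open>\<delta>\<close>.

  The group-theoretic part (lemma \<open>additive_direction_exists\<close>) is that one of the two
  conditions always holds.  A non-zero zero of \<open>f\<close> is a period of \<open>f\<close>, hence a suitable
  \<open>\<gamma>\<close>.  Suppose that \<open>f\<close> has no such zero and that the second condition fails, so that
  there are non-zero \<open>b\<close>, \<open>c\<close> with \<open>f b \<noteq> f c\<close> and \<open>b + c \<noteq> 0\<close>.  Then \<open>f\<close> is injective, so
  \<open>f (\<alpha> + \<beta>) = f \<alpha> + f \<beta>\<close> for \<open>\<alpha> \<noteq> \<beta>\<close>, and there are at least the four elements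
  \<open>0\<close>, \<open>b\<close>, \<open>c\<close>, \<open>b + c\<close>; this leaves room to deduce \<open>f (2 \<alpha>) = 2 f \<alpha>\<close> too.
  So \<open>f\<close> is additive, and every \<open>\<gamma> \<noteq> 0\<close> is suitable.  The bound of four elements is sharp: on the
  group of order 3 the function with values \<open>0, 1, -1\<close> satisfies the functional equation
  but is not additive.
\<close>

section \<open>The functional equation\<close>

text \<open>
  The zeros of \<open>f\<close> form a subgroup: \<open>-\<gamma>\<close> is a zero along with \<open>\<gamma>\<close>, for otherwise the two
  values differ and would add up to \<open>f 0 = 0\<close>.  Translating by \<open>\<gamma>\<close> or back by \<open>-\<gamma>\<close>
  then preserves every non-zero value, hence also the value \<open>0\<close>.
\<close>

lemma zero_is_period:
  fixes f :: "'g::ab_group_add \<Rightarrow> 'k::ab_group_add"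
  assumes f0: "f 0 = 0"
    and add: "\<And>\<alpha> \<beta>. f \<alpha> \<noteq> f \<beta> \<Longrightarrow> f (\<alpha> + \<beta>) = f \<alpha> + f \<beta>"
    and \<gamma>: "f \<gamma> = 0"
  shows "f (\<alpha> + \<gamma>) = f \<alpha>"
proof (cases "f \<alpha> = 0")
  case False
  then show ?thesis using add[of \<alpha> \<gamma>] \<gamma> by simp
next
  case True
  have neg: "f (- \<gamma>) = 0"
    using add[of "- \<gamma>" \<gamma>] \<gamma> f0 by force
  have "f (\<alpha> + \<gamma>) = 0"
    using add[of "\<alpha> + \<gamma>" "- \<gamma>"] neg True by force
  then show ?thesis using True by simp
qed

text \<open>
  If \<open>f x = f y = v\<close> with \<open>x \<noteq> y\<close>, write each of \<open>x\<close>, \<open>y\<close> as the other plus \<open>\<plusminus>d\<close>, where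
  \<open>d = x - y\<close>.  Since \<open>f (\<plusminus>d) \<noteq> 0\<close>, additivity is impossible there, and so
  \<open>f d = f (- d) = v\<close>.  Going from a non-zero element \<open>z\<close> of another value to \<open>z - d\<close> and
  back then adds \<open>v\<close> twice, although it returns to \<open>z\<close>.
\<close>

lemma inj_if_no_zero_and_two_values:
  fixes f :: "'g::ab_group_add \<Rightarrow> 'k::{ring_1_no_zero_divisors,ring_char_0}"
  assumes add: "\<And>\<alpha> \<beta>. f \<alpha> \<noteq> f \<beta> \<Longrightarrow> f (\<alpha> + \<beta>) = f \<alpha> + f \<beta>"
    and nz: "\<And>\<gamma>. \<gamma> \<noteq> 0 \<Longrightarrow> f \<gamma> \<noteq> 0"
    and bc: "b \<noteq> 0" "c \<noteq> 0" "f b \<noteq> f c"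
  shows "inj f"
proof (rule injI, rule ccontr)
  fix x y
  assume eq: "f x = f y" and ne: "x \<noteq> y"
  define d where "d = x - y"
  obtain z where z: "z \<noteq> 0" "f z \<noteq> f x" using bc by metis
  have d: "f d \<noteq> 0" "f (- d) \<noteq> 0"
    using ne by (auto simp: d_def intro!: nz)
  have fd: "f d = f x"
    using add[of d y] d eq by (force simp: d_def)
  have fmd: "f (- d) = f x"
    using add[of "- d" x] d eq by (force simp: d_def)
  have step: "f (z + - d) = f z + f x"
    using add[of z "- d"] fmd z by simp
  moreover have "f z \<noteq> 0" using nz z by blast
  ultimately have "f (z + - d) \<noteq> f d" using fd by simp
  from add[OF this] have "f z = f z + f x + f x"
    using step fd by simp
  then have "f x + f x = 0" by (metis add.assoc add_cancel_right_right)
  then have "2 * f x = 0" by (simp add: mult_2)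
  then show False using d fd by simp
qed

text \<open>
  Only \<open>f (2 \<alpha>) = 2 f \<alpha>\<close> is in question.  For any \<open>d\<close> outside \<open>{0, \<alpha>, 2 \<alpha>}\<close> the value
  \<open>f (2 \<alpha> + d)\<close> can be computed as \<open>f (2 \<alpha>) + f d\<close> and as \<open>f \<alpha> + f (\<alpha> + d)\<close>.
\<close>

lemma additive_if_inj_and_four_elements:
  fixes f :: "'g::ab_group_add \<Rightarrow> 'k::ab_group_add" and b c :: 'g
  assumes f0: "f 0 = 0"
    and add: "\<And>\<alpha> \<beta>. f \<alpha> \<noteq> f \<beta> \<Longrightarrow> f (\<alpha> + \<beta>) = f \<alpha> + f \<beta>"
    and inj: "inj f"
    and bc: "b \<noteq> 0" "c \<noteq> 0" "b \<noteq> c" "b + c \<noteq> 0"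
  shows "f (\<alpha> + \<beta>) = f \<alpha> + f \<beta>"
proof (cases "\<alpha> = \<beta> \<and> \<alpha> \<noteq> 0")
  case False
  then show ?thesis using add[of \<alpha> \<beta>] inj f0 by (auto dest: injD)
next
  case True
  \<comment> \<open>The four distinct elements \<open>0\<close>, \<open>b\<close>, \<open>c\<close>, \<open>b + c\<close> cannot all lie in \<open>{0, \<alpha>, 2 \<alpha>}\<close>.\<close>
  obtain d where d: "d \<noteq> 0" "d \<noteq> \<alpha>" "d \<noteq> \<alpha> + \<alpha>"
  proof -
    have "card {0, b, c, b + c} = 4" using bc by auto
    moreover have "card {0, \<alpha>, \<alpha> + \<alpha>} \<le> 3" by (simp add: card_insert_if)
    ultimately have "\<not> {0, b, c, b + c} \<subseteq> {0, \<alpha>, \<alpha> + \<alpha>}"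
      using card_mono[of "{0, \<alpha>, \<alpha> + \<alpha>}" "{0, b, c, b + c}"] by auto
    then show ?thesis using that by auto
  qed
  have distinct: "f x \<noteq> f y" if "x \<noteq> y" for x y
    using that inj by (auto dest: injD)
  have "f (\<alpha> + \<alpha>) + f d = f (\<alpha> + \<alpha> + d)"
    using d by (intro add[symmetric] distinct) auto
  also have "\<dots> = f (\<alpha> + (\<alpha> + d))" by (simp add: add.assoc)
  also have "\<dots> = f \<alpha> + f (\<alpha> + d)"
    using d by (intro add distinct) auto
  also have "f (\<alpha> + d) = f \<alpha> + f d"
    using d by (intro add distinct) auto
  finally show ?thesis using True by (simp add: add.assoc[symmetric])
qed

lemma additive_direction_exists:
  fixes f :: "'g::ab_group_add \<Rightarrow> 'k::{ring_1_no_zero_divisors,ring_char_0}"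
  assumes f0: "f 0 = 0"
    and add: "\<And>\<alpha> \<beta>. f \<alpha> \<noteq> f \<beta> \<Longrightarrow> f (\<alpha> + \<beta>) = f \<alpha> + f \<beta>"
    and bc: "b \<noteq> 0" "c \<noteq> 0" "f b \<noteq> f c" "b + c \<noteq> 0"
  shows "\<exists>\<gamma>. \<gamma> \<noteq> 0 \<and> (\<forall>\<alpha>. f (\<alpha> + \<gamma>) = f \<alpha> + f \<gamma>)"
proof (cases "\<exists>\<gamma>. \<gamma> \<noteq> 0 \<and> f \<gamma> = 0")
  case True
  then show ?thesis using zero_is_period[of f, OF f0 add] by force
next
  case False
  then have "inj f"
    using inj_if_no_zero_and_two_values[of f, OF add] bc by blast
  moreover have "b \<noteq> c" using bc by auto
  ultimately have "f (\<alpha> + b) = f \<alpha> + f b" for \<alpha>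
    using additive_if_inj_and_four_elements[of f, OF f0 add] bc by blast
  then show ?thesis using bc by blast
qed

section \<open>Hom-Lie structures on the Witt type Lie algebra\<close>

lemma hom_lie_structure_witt_basisI:
  fixes f :: "'g::ab_group_add \<Rightarrow> complex"
  assumes lie: "lie_algebra pm_scale (witt_bracket f)"
    and lin\<phi>: "Vector_Spaces.linear pm_scale pm_scale \<phi>"
    and basis: "\<And>a b c.
      let e = (\<lambda>\<alpha>. Poly_Mapping.single \<alpha> 1); br = witt_bracket f in
      br (\<phi> (e a)) (br (e b) (e c)) + br (\<phi> (e b)) (br (e c) (e a))
        + br (\<phi> (e c)) (br (e a) (e b)) = 0"
  shows "hom_lie_structure pm_scale (witt_bracket f) \<phi>"
proof -
  let ?b = "witt_bracket f"
  let ?e = "\<lambda>\<alpha>::'g. Poly_Mapping.single \<alpha> (1::complex)"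
  let ?J = "\<lambda>x y z. ?b (\<phi> x) (?b y z) + ?b (\<phi> y) (?b z x) + ?b (\<phi> z) (?b x y)"
  note L = linear_witt_left[of f, unfolded Vector_Spaces.linear_iff]
    linear_witt_right[of f, unfolded Vector_Spaces.linear_iff]
    lin\<phi>[unfolded Vector_Spaces.linear_iff]
  have linear_rules:
    "?b (pm_scale k x) y = pm_scale k (?b x y)"
    "?b x (pm_scale k y) = pm_scale k (?b x y)"
    "?b (x + x') y = ?b x y + ?b x' y"
    "?b x (y + y') = ?b x y + ?b x y'"
    "\<phi> (pm_scale k x) = pm_scale k (\<phi> x)"
    "\<phi> (x + x') = \<phi> x + \<phi> x'" for k x x' y y'
    using L by auto
  have lin: "Vector_Spaces.linear pm_scale pm_scale (\<lambda>x. ?J x y z)"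
    "Vector_Spaces.linear pm_scale pm_scale (\<lambda>y. ?J x y z)"
    "Vector_Spaces.linear pm_scale pm_scale (\<lambda>z. ?J x y z)" for x y z
    by (simp_all add: Vector_Spaces.linear_iff vector_space_pm_scale linear_rules
        pm.scale_right_distrib algebra_simps)
  have "?J (?e a) (?e b) (?e c) = 0" for a b c
    using basis[of a b c] by (simp add: Let_def)
  then have "?J (?e a) (?e b) z = 0" for a b z
    by (rule pm_induct[OF lin(3)])
  then have "?J (?e a) y z = 0" for a y z
    by (rule pm_induct[OF lin(2)])
  then have "?J x y z = 0" for x y z
    by (rule pm_induct[OF lin(1)])
  then show ?thesis
    by (intro hom_lie_structure.intro hom_lie_structure_axioms.intro lie lin\<phi>)
qed

lemma witt_bracket_single:
  "witt_bracket f (Poly_Mapping.single \<alpha> c) (Poly_Mapping.single \<beta> d) =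
    Poly_Mapping.single (\<alpha> + \<beta>) (c * d * (f \<beta> - f \<alpha>))"
  by (rule poly_mapping_eqI) (simp add: witt_bracket_def lookup_single when_def)

text \<open>
  The product below is the convolution product of the group algebra, in which multiplication
  by \<open>e\<^sub>\<gamma>\<close> is the shift by \<open>\<gamma>\<close>.
\<close>

lemma hom_lie_structure_shift:
  fixes f :: "'g::ab_group_add \<Rightarrow> complex"
  assumes lie: "lie_algebra pm_scale (witt_bracket f)"
    and add: "\<And>\<alpha> \<beta>. f \<alpha> \<noteq> f \<beta> \<Longrightarrow> f (\<alpha> + \<beta>) = f \<alpha> + f \<beta>"
    and \<gamma>: "\<And>\<alpha>. f (\<alpha> + \<gamma>) = f \<alpha> + f \<gamma>"
  shows "hom_lie_structure pm_scale (witt_bracket f) (\<lambda>x. x * Poly_Mapping.single \<gamma> 1)"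
proof (rule hom_lie_structure_witt_basisI[OF lie], goal_cases)
  case 1
  have scale: "pm_scale c x = Poly_Mapping.single 0 c * x" for c and x :: "'g \<Rightarrow>\<^sub>0 complex"
    by (simp add: pm_scale_def mult_map_scale_conv_mult)
  show ?case
    by (simp add: Vector_Spaces.linear_iff vector_space_pm_scale distrib_right scale mult.assoc)
next
  case (2 a b c)
  have coef: "(f y - f x) * (f (x + y) - u) = (f y - f x) * (f x + f y - u)" for x y u
    using add[of x y] by (cases "f x = f y") auto
  let ?e = "\<lambda>\<alpha>::'g. Poly_Mapping.single \<alpha> (1::complex)"
  have cyc: "witt_bracket f (?e x * ?e \<gamma>) (witt_bracket f (?e y) (?e z)) =
      Poly_Mapping.single (x + y + z + \<gamma>) ((f z - f y) * (f y + f z - (f x + f \<gamma>)))" for x y z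
  proof -
    have "witt_bracket f (?e x * ?e \<gamma>) (witt_bracket f (?e y) (?e z)) =
        Poly_Mapping.single (x + \<gamma> + (y + z)) ((f z - f y) * (f (y + z) - f (x + \<gamma>)))"
      by (simp only: witt_bracket_single mult_single mult_1_left)
    also have "\<dots> = Poly_Mapping.single (x + \<gamma> + (y + z))
        ((f z - f y) * (f y + f z - (f x + f \<gamma>)))"
      by (simp only: \<gamma> coef)
    finally show ?thesis by (simp add: add_ac)
  qed
  have idx: "b + c + a + \<gamma> = a + b + c + \<gamma>" "c + a + b + \<gamma> = a + b + c + \<gamma>"
    by (simp_all add: add_ac)
  show ?case
    unfolding Let_def cyc idx single_add[symmetric] by (simp add: algebra_simps)
qed

text \<open>
  With \<open>b\<close>, \<open>c\<close> non-zero the term \<open>[e\<^sub>0, [e\<^sub>b, e\<^sub>c]]\<close> has the coefficient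
  \<open>(f c - f b) f (b + c)\<close>, one factor of which is zero by hypothesis.  If two of the three
  basis vectors are \<open>e\<^sub>0\<close>, their contributions cancel by antisymmetry.
\<close>

lemma hom_lie_structure_projection:
  fixes f :: "'g::ab_group_add \<Rightarrow> complex"
  assumes lie: "lie_algebra pm_scale (witt_bracket f)"
    and f0: "f 0 = 0"
    and opp: "\<And>b c. b \<noteq> 0 \<Longrightarrow> c \<noteq> 0 \<Longrightarrow> f b \<noteq> f c \<Longrightarrow> b + c = 0"
  shows "hom_lie_structure pm_scale (witt_bracket f)
    (\<lambda>x. Poly_Mapping.single 0 (Poly_Mapping.lookup x 0))"
proof (rule hom_lie_structure_witt_basisI[OF lie], goal_cases)
  case 1
  show ?case
    by (simp add: Vector_Spaces.linear_iff vector_space_pm_scale lookup_add single_add)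
next
  case (2 a b c)
  have vanish: "f y * f (x + y) - f x * f (x + y) = 0" "f x * f (x + y) - f y * f (x + y) = 0"
    if "x \<noteq> 0" "y \<noteq> 0" for x y
    using opp[OF that] f0 by (cases "f x = f y"; simp)+
  show ?case
    unfolding Let_def witt_bracket_single lookup_single
    by (cases "a = 0"; cases "b = 0"; cases "c = 0")
      (simp_all add: f0 vanish when_def single_add[symmetric] algebra_simps)
qed

theorem corollary22:
  fixes f :: "'g::ab_group_add \<Rightarrow> complex"
  assumes "f 0 = 0"
    and "infinite (range f) \<or> card (range f) \<ge> 2"
    and "\<And>\<alpha> \<beta>. (f (\<alpha> + \<beta>) - f \<alpha> - f \<beta>) * (f \<alpha> - f \<beta>) = 0"
  shows "\<exists>\<phi>. nontrivial_hom_lie_structure pm_scale (witt_bracket f) \<phi>"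
proof -
  note lie = lie_algebra_witt[of f, OF assms(3)]
  have add: "f (\<alpha> + \<beta>) = f \<alpha> + f \<beta>" if "f \<alpha> \<noteq> f \<beta>" for \<alpha> \<beta>
    using assms(3)[of \<alpha> \<beta>] that by (simp add: diff_diff_eq)
  show ?thesis
  proof (cases "\<exists>\<gamma>. \<gamma> \<noteq> 0 \<and> (\<forall>\<alpha>. f (\<alpha> + \<gamma>) = f \<alpha> + f \<gamma>)")
    case True
    then obtain \<gamma> where \<gamma>: "\<gamma> \<noteq> 0" "\<And>\<alpha>. f (\<alpha> + \<gamma>) = f \<alpha> + f \<gamma>" by blast
    let ?\<phi> = "\<lambda>x::'g \<Rightarrow>\<^sub>0 complex. x * Poly_Mapping.single \<gamma> 1"
    have "?\<phi> (Poly_Mapping.single 0 1) \<noteq> pm_scale k (Poly_Mapping.single 0 1)" for k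
    proof
      assume "?\<phi> (Poly_Mapping.single 0 1) = pm_scale k (Poly_Mapping.single 0 1)"
      then have "Poly_Mapping.lookup (?\<phi> (Poly_Mapping.single 0 1)) \<gamma>
        = Poly_Mapping.lookup (pm_scale k (Poly_Mapping.single 0 1)) \<gamma>" by simp
      then show False using \<gamma>(1) by (simp add: lookup_single lookup_one when_def)
    qed
    then show ?thesis
      using hom_lie_structure_shift[OF lie add \<gamma>(2)]
      unfolding nontrivial_hom_lie_structure_def by blast
  next
    case False
    then have opp: "b + c = 0" if "b \<noteq> 0" "c \<noteq> 0" "f b \<noteq> f c" for b c
      using additive_direction_exists[of f, OF assms(1) add] that by blast
    obtain b where b: "b \<noteq> (0::'g)"
    proof (rule ccontr)
      assume "\<not> thesis"
      then have "(UNIV :: 'g set) = {0}" using that by auto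
      then have "range f = {f 0}" by (metis image_empty image_insert)
      then show False using assms(2) by simp
    qed
    let ?\<phi> = "\<lambda>x::'g \<Rightarrow>\<^sub>0 complex. Poly_Mapping.single (0::'g) (Poly_Mapping.lookup x 0)"
    \<comment> \<open>The projection kills \<open>e\<^sub>b\<close> and fixes \<open>e\<^sub>0\<close>.\<close>
    have "\<not> (\<forall>x. ?\<phi> x = pm_scale k x)" for k
    proof
      assume k: "\<forall>x. ?\<phi> x = pm_scale k x"
      have "?\<phi> (Poly_Mapping.single b 1) = 0" using b by (simp add: lookup_single)
      then have "Poly_Mapping.lookup (pm_scale k (Poly_Mapping.single b 1)) b = 0"
        using k by simp
      then have "k = 0" by simp
      moreover have "Poly_Mapping.lookup (?\<phi> (Poly_Mapping.single 0 1)) 0 = 1" by simp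
      moreover have "?\<phi> (Poly_Mapping.single 0 1) = pm_scale k (Poly_Mapping.single 0 1)"
        using k by blast
      ultimately show False by simp
    qed
    then show ?thesis
      using hom_lie_structure_projection[OF lie assms(1) opp]
      unfolding nontrivial_hom_lie_structure_def by blast
  qed
qed

end
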